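(* Let $k$ be a commutative rig, $(\mathcal C,\otimes,I)$ a $k$-linear symmetric monoidal category with finite biproducts, and $!\colon\mathcal C\to\mathcal C$ an endofunctor. Suppose given, for each $X\in\mathcal C$, maps $\mathsf d_X\colon !X\otimes X\to !X$, $\mathsf e_X\colon !X\to I$, $\Delta_X\colon !X\to !X\otimes !X$ and $\varepsilon_X\colon !X\to X$ such that each $(!X,\Delta_X,\mathsf e_X)$ is a cocommutative comonoid and $\mathsf d$ satisfies the interchange, constant, product and linear rules. Suppose further given a family of maps $\delta_X\colon !X\to !!X$ which are comonoid morphisms for $(\Delta,\mathsf e)$ and satisfy the counit law $\varepsilon_{!X}\circ\delta_X=1$. Then $\delta_X$ is a map of commuting $X$-actions $$\delta_X\colon(!X,\mathsf d_X)\to !^X(!X,\mathsf d_X)$$ for each $X\in\mathcal C$ if, and only if, $\mathsf d$ satisfies the chain rule $\delta_X\circ\mathsf d_X=\mathsf d_{!X}\circ(\delta_X\otimes\mathsf d_X)\circ(\Delta_X\otimes X)$ for each $X\in\mathcal C$.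
   Context: Associativity and unit constraints are suppressed; $\sigma$ is the symmetry. A symmetric monoidal category is $k$-linear if each hom-set is a $k$-module and composition and tensor of morphisms are $k$-linear in each variable. The rules are: - interchange: $\mathsf d_X\circ(\mathsf d_X\otimes X)\circ(!X\otimes\sigma_{X,X})=\mathsf d_X\circ(\mathsf d_X\otimes X)$; - constant: $\mathsf e_X\circ\mathsf d_X=0$; - product: $\Delta_X\circ\mathsf d_X=\big[(!X\otimes\mathsf d_X)+(\mathsf d_X\otimes !X)\circ(!X\otimes\sigma_{!X,X})\big]\circ(\Delta_X\otimes X)$; - linear: $\varepsilon_X\circ\mathsf d_X=\mathsf e_X\otimes X$. A commuting $X$-action is a pair $(A,\alpha\colon A\otimes X\to A)$ with $\alpha\circ(\alpha\otimes X)\circ(A\otimes\sigma_{X,X})=\alpha\circ(\alpha\otimes X)$; a map $(A,\alpha)\to(B,\beta)$ is $f\colon A\to B$ with $f\circ\alpha=\beta\circ(f\otimes X)$. By the interchange rule $(!X,\mathsf d_X)$ is a commuting $X$-action. Put $\mathsf b_A=(!A\otimes\varepsilon_A)\circ\Delta_A\colon !A\to !A\otimes A$. For a commuting $X$-action $(A,\alpha)$, $!^X(A,\alpha)$ is the commuting $X$-action $(!A,\ \mathsf d_A\circ(!A\otimes\alpha)\circ(\mathsf b_A\otimes X))$. *)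

theory Defs
  imports Main
begin

section \<open>Categories\<close>

record ('o, 'm) cat =
  obj :: "'o set"
  arr :: "'m set"
  src :: "'m \<Rightarrow> 'o"
  tgt :: "'m \<Rightarrow> 'o"
  ident :: "'o \<Rightarrow> 'm" (\<open>\<one>\<index>\<close>)
  compose :: "'m \<Rightarrow> 'm \<Rightarrow> 'm" (infixl \<open>\<cdot>\<index>\<close> 55)

context
  fixes C :: "('o, 'm, 'z) cat_scheme" (structure)
begin

definition hom :: "'o \<Rightarrow> 'o \<Rightarrow> 'm set"
  where "hom A B = {f \<in> arr C. src C f = A \<and> tgt C f = B}"

definition inverse_arrows :: "'m \<Rightarrow> 'm \<Rightarrow> bool"
  where "inverse_arrows f g \<longleftrightarrow>
    f \<in> arr C \<and> g \<in> hom (tgt C f) (src C f) \<and>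
    g \<cdot> f = \<one> (src C f) \<and> f \<cdot> g = \<one> (tgt C f)"

definition iso :: "'m \<Rightarrow> bool"
  where "iso f \<longleftrightarrow> (\<exists>g. inverse_arrows f g)"

definition inv_arr :: "'m \<Rightarrow> 'm"
  where "inv_arr f = (THE g. inverse_arrows f g)"

end

locale category =
  fixes C :: "('o, 'm, 'z) cat_scheme" (structure)
  assumes src_obj: "f \<in> arr C \<Longrightarrow> src C f \<in> obj C"
    and tgt_obj: "f \<in> arr C \<Longrightarrow> tgt C f \<in> obj C"
    and ident_hom: "A \<in> obj C \<Longrightarrow> \<one> A \<in> hom C A A"
    and compose_hom: "f \<in> hom C A B \<Longrightarrow> g \<in> hom C B D \<Longrightarrow> g \<cdot> f \<in> hom C A D"
    and compose_ident: "f \<in> hom C A B \<Longrightarrow> f \<cdot> \<one> A = f"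
    and ident_compose: "f \<in> hom C A B \<Longrightarrow> \<one> B \<cdot> f = f"
    and compose_assoc: "f \<in> hom C A B \<Longrightarrow> g \<in> hom C B D \<Longrightarrow> h \<in> hom C D E \<Longrightarrow>
      (h \<cdot> g) \<cdot> f = h \<cdot> (g \<cdot> f)"

definition endofunctor :: "('o, 'm, 'z) cat_scheme \<Rightarrow> ('o \<Rightarrow> 'o) \<Rightarrow> ('m \<Rightarrow> 'm) \<Rightarrow> bool"
  where "endofunctor C Fo Fm \<longleftrightarrow>
    (\<forall>A \<in> obj C. Fo A \<in> obj C) \<and>
    (\<forall>A B f. f \<in> hom C A B \<longrightarrow> Fm f \<in> hom C (Fo A) (Fo B)) \<and>
    (\<forall>A \<in> obj C. Fm (\<one>\<^bsub>C\<^esub> A) = \<one>\<^bsub>C\<^esub> (Fo A)) \<and>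
    (\<forall>A B D f g. f \<in> hom C A B \<longrightarrow> g \<in> hom C B D \<longrightarrow>
      Fm (g \<cdot>\<^bsub>C\<^esub> f) = Fm g \<cdot>\<^bsub>C\<^esub> Fm f)"


section \<open>Symmetric monoidal categories\<close>

record ('o, 'm) smc = "('o, 'm) cat" +
  tensor_obj :: "'o \<Rightarrow> 'o \<Rightarrow> 'o" (infixr \<open>\<otimes>\<^sub>o\<index>\<close> 70)
  tensor :: "'m \<Rightarrow> 'm \<Rightarrow> 'm" (infixr \<open>\<otimes>\<index>\<close> 70)
  unit_obj :: 'o (\<open>I\<index>\<close>)
  associator :: "'o \<Rightarrow> 'o \<Rightarrow> 'o \<Rightarrow> 'm" (\<open>\<a>\<index>\<close>)
  left_unitor :: "'o \<Rightarrow> 'm" (\<open>\<l>\<index>\<close>)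
  right_unitor :: "'o \<Rightarrow> 'm" (\<open>\<r>\<index>\<close>)
  symmetry :: "'o \<Rightarrow> 'o \<Rightarrow> 'm" (\<open>\<sigma>\<index>\<close>)

locale symmetric_monoidal_category = category C
  for C :: "('o, 'm, 'z) smc_scheme" (structure) +
  assumes tensor_obj: "A \<in> obj C \<Longrightarrow> B \<in> obj C \<Longrightarrow> A \<otimes>\<^sub>o B \<in> obj C"
    and unit_obj: "I \<in> obj C"
    and tensor_hom: "f \<in> hom C A A' \<Longrightarrow> g \<in> hom C B B' \<Longrightarrow>
      f \<otimes> g \<in> hom C (A \<otimes>\<^sub>o B) (A' \<otimes>\<^sub>o B')"
    and tensor_ident: "A \<in> obj C \<Longrightarrow> B \<in> obj C \<Longrightarrow> \<one> A \<otimes> \<one> B = \<one> (A \<otimes>\<^sub>o B)"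
    and tensor_compose: "f \<in> hom C A A' \<Longrightarrow> f' \<in> hom C A' A'' \<Longrightarrow>
      g \<in> hom C B B' \<Longrightarrow> g' \<in> hom C B' B'' \<Longrightarrow>
      (f' \<cdot> f) \<otimes> (g' \<cdot> g) = (f' \<otimes> g') \<cdot> (f \<otimes> g)"
    and associator_hom: "A \<in> obj C \<Longrightarrow> B \<in> obj C \<Longrightarrow> D \<in> obj C \<Longrightarrow>
      \<a> A B D \<in> hom C ((A \<otimes>\<^sub>o B) \<otimes>\<^sub>o D) (A \<otimes>\<^sub>o (B \<otimes>\<^sub>o D))"
    and associator_iso: "A \<in> obj C \<Longrightarrow> B \<in> obj C \<Longrightarrow> D \<in> obj C \<Longrightarrow> iso C (\<a> A B D)"
    and associator_natural:
      "f \<in> hom C A A' \<Longrightarrow> g \<in> hom C B B' \<Longrightarrow> h \<in> hom C D D' \<Longrightarrow>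
      \<a> A' B' D' \<cdot> ((f \<otimes> g) \<otimes> h) = (f \<otimes> (g \<otimes> h)) \<cdot> \<a> A B D"
    and left_unitor_hom: "A \<in> obj C \<Longrightarrow> \<l> A \<in> hom C (I \<otimes>\<^sub>o A) A"
    and left_unitor_iso: "A \<in> obj C \<Longrightarrow> iso C (\<l> A)"
    and left_unitor_natural: "f \<in> hom C A A' \<Longrightarrow> \<l> A' \<cdot> (\<one> I \<otimes> f) = f \<cdot> \<l> A"
    and right_unitor_hom: "A \<in> obj C \<Longrightarrow> \<r> A \<in> hom C (A \<otimes>\<^sub>o I) A"
    and right_unitor_iso: "A \<in> obj C \<Longrightarrow> iso C (\<r> A)"
    and right_unitor_natural: "f \<in> hom C A A' \<Longrightarrow> \<r> A' \<cdot> (f \<otimes> \<one> I) = f \<cdot> \<r> A"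
    and symmetry_hom: "A \<in> obj C \<Longrightarrow> B \<in> obj C \<Longrightarrow> \<sigma> A B \<in> hom C (A \<otimes>\<^sub>o B) (B \<otimes>\<^sub>o A)"
    and symmetry_natural: "f \<in> hom C A A' \<Longrightarrow> g \<in> hom C B B' \<Longrightarrow>
      \<sigma> A' B' \<cdot> (f \<otimes> g) = (g \<otimes> f) \<cdot> \<sigma> A B"
    and symmetry_involution: "A \<in> obj C \<Longrightarrow> B \<in> obj C \<Longrightarrow> \<sigma> B A \<cdot> \<sigma> A B = \<one> (A \<otimes>\<^sub>o B)"
    and pentagon:
      "A \<in> obj C \<Longrightarrow> B \<in> obj C \<Longrightarrow> D \<in> obj C \<Longrightarrow> E \<in> obj C \<Longrightarrow>
      (\<one> A \<otimes> \<a> B D E) \<cdot> \<a> A (B \<otimes>\<^sub>o D) E \<cdot> (\<a> A B D \<otimes> \<one> E) =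
      \<a> A B (D \<otimes>\<^sub>o E) \<cdot> \<a> (A \<otimes>\<^sub>o B) D E"
    and triangle: "A \<in> obj C \<Longrightarrow> B \<in> obj C \<Longrightarrow> (\<one> A \<otimes> \<l> B) \<cdot> \<a> A I B = \<r> A \<otimes> \<one> B"
    and hexagon:
      "A \<in> obj C \<Longrightarrow> B \<in> obj C \<Longrightarrow> D \<in> obj C \<Longrightarrow>
      \<a> B D A \<cdot> \<sigma> A (B \<otimes>\<^sub>o D) \<cdot> \<a> A B D =
      (\<one> B \<otimes> \<sigma> A D) \<cdot> \<a> B A D \<cdot> (\<sigma> A B \<otimes> \<one> D)"

context
  fixes C :: "('o, 'm, 'z) smc_scheme" (structure)
begin

definition cocommutative_comonoid :: "'o \<Rightarrow> 'm \<Rightarrow> 'm \<Rightarrow> bool"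
  where "cocommutative_comonoid A \<Delta> e \<longleftrightarrow>
    A \<in> obj C \<and> \<Delta> \<in> hom C A (A \<otimes>\<^sub>o A) \<and> e \<in> hom C A I \<and>
    \<a> A A A \<cdot> (\<Delta> \<otimes> \<one> A) \<cdot> \<Delta> = (\<one> A \<otimes> \<Delta>) \<cdot> \<Delta> \<and>
    \<l> A \<cdot> (e \<otimes> \<one> A) \<cdot> \<Delta> = \<one> A \<and>
    \<r> A \<cdot> (\<one> A \<otimes> e) \<cdot> \<Delta> = \<one> A \<and>
    \<sigma> A A \<cdot> \<Delta> = \<Delta>"

definition comonoid_morphism :: "'o \<Rightarrow> 'm \<Rightarrow> 'm \<Rightarrow> 'o \<Rightarrow> 'm \<Rightarrow> 'm \<Rightarrow> 'm \<Rightarrow> bool"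
  where "comonoid_morphism A \<Delta>\<^sub>A e\<^sub>A B \<Delta>\<^sub>B e\<^sub>B f \<longleftrightarrow>
    f \<in> hom C A B \<and> \<Delta>\<^sub>B \<cdot> f = (f \<otimes> f) \<cdot> \<Delta>\<^sub>A \<and> e\<^sub>B \<cdot> f = e\<^sub>A"

definition commuting_action :: "'o \<Rightarrow> 'o \<times> 'm \<Rightarrow> bool"
  where "commuting_action X = (\<lambda>(A, \<alpha>).
    A \<in> obj C \<and> \<alpha> \<in> hom C (A \<otimes>\<^sub>o X) A \<and>
    \<alpha> \<cdot> (\<alpha> \<otimes> \<one> X) \<cdot> inv_arr C (\<a> A X X) \<cdot> (\<one> A \<otimes> \<sigma> X X) \<cdot> \<a> A X X =
    \<alpha> \<cdot> (\<alpha> \<otimes> \<one> X))"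

text \<open>Source and target of a map of commuting actions are required to be commuting actions,
  so that a map into a constructed action includes the claim that the construction is an action.\<close>

definition action_map :: "'o \<Rightarrow> 'o \<times> 'm \<Rightarrow> 'o \<times> 'm \<Rightarrow> 'm \<Rightarrow> bool"
  where "action_map X = (\<lambda>(A, \<alpha>) (B, \<beta>) f.
    commuting_action X (A, \<alpha>) \<and> commuting_action X (B, \<beta>) \<and>
    f \<in> hom C A B \<and> f \<cdot> \<alpha> = \<beta> \<cdot> (f \<otimes> \<one> X))"

end


section \<open>Linear structure and biproducts\<close>

text \<open>The sort of the scalars is that of a commutative rig; unlike \<^class>\<open>comm_semiring_1\<close>
  it does not exclude the rig in which zero and one coincide.\<close>

locale rig_module =
  fixes M :: "'m set" and add :: "'m \<Rightarrow> 'm \<Rightarrow> 'm" and zero :: 'm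
    and smult :: "'k::{comm_semiring_0, comm_monoid_mult} \<Rightarrow> 'm \<Rightarrow> 'm"
  assumes add_closed: "f \<in> M \<Longrightarrow> g \<in> M \<Longrightarrow> add f g \<in> M"
    and zero_closed: "zero \<in> M"
    and smult_closed: "f \<in> M \<Longrightarrow> smult r f \<in> M"
    and add_assoc: "f \<in> M \<Longrightarrow> g \<in> M \<Longrightarrow> h \<in> M \<Longrightarrow> add (add f g) h = add f (add g h)"
    and add_commute: "f \<in> M \<Longrightarrow> g \<in> M \<Longrightarrow> add f g = add g f"
    and add_zero: "f \<in> M \<Longrightarrow> add f zero = f"
    and smult_add: "f \<in> M \<Longrightarrow> g \<in> M \<Longrightarrow> smult r (add f g) = add (smult r f) (smult r g)"
    and smult_zero: "smult r zero = zero"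
    and add_smult: "f \<in> M \<Longrightarrow> smult (r + s) f = add (smult r f) (smult s f)"
    and zero_smult: "f \<in> M \<Longrightarrow> smult 0 f = zero"
    and mult_smult: "f \<in> M \<Longrightarrow> smult (r * s) f = smult r (smult s f)"
    and one_smult: "f \<in> M \<Longrightarrow> smult 1 f = f"

record ('o, 'm, 'k) linear_smc = "('o, 'm) smc" +
  add_arr :: "'m \<Rightarrow> 'm \<Rightarrow> 'm" (infixl \<open>\<oplus>\<index>\<close> 52)
  zero_arr :: "'o \<Rightarrow> 'o \<Rightarrow> 'm" (\<open>\<zero>\<index>\<close>)
  smult_arr :: "'k \<Rightarrow> 'm \<Rightarrow> 'm" (infixr \<open>\<odot>\<index>\<close> 75)

text \<open>Preservation of zero morphisms by composition and tensor follows from preservation of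
  multiplication by the scalar zero.\<close>

locale linear_symmetric_monoidal_category = symmetric_monoidal_category C
  for C :: "('o, 'm, 'k::{comm_semiring_0, comm_monoid_mult}, 'z) linear_smc_scheme" (structure) +
  assumes hom_module: "A \<in> obj C \<Longrightarrow> B \<in> obj C \<Longrightarrow>
      rig_module (hom C A B) (add_arr C) (\<zero> A B) (smult_arr C)"
    and compose_add_left: "f \<in> hom C A B \<Longrightarrow> g \<in> hom C B D \<Longrightarrow> g' \<in> hom C B D \<Longrightarrow>
      (g \<oplus> g') \<cdot> f = (g \<cdot> f) \<oplus> (g' \<cdot> f)"
    and compose_add_right: "f \<in> hom C A B \<Longrightarrow> f' \<in> hom C A B \<Longrightarrow> g \<in> hom C B D \<Longrightarrow>
      g \<cdot> (f \<oplus> f') = (g \<cdot> f) \<oplus> (g \<cdot> f')"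
    and compose_smult_left: "f \<in> hom C A B \<Longrightarrow> g \<in> hom C B D \<Longrightarrow> (r \<odot> g) \<cdot> f = r \<odot> (g \<cdot> f)"
    and compose_smult_right: "f \<in> hom C A B \<Longrightarrow> g \<in> hom C B D \<Longrightarrow> g \<cdot> (r \<odot> f) = r \<odot> (g \<cdot> f)"
    and tensor_add_left: "f \<in> hom C A A' \<Longrightarrow> f' \<in> hom C A A' \<Longrightarrow> g \<in> hom C B B' \<Longrightarrow>
      (f \<oplus> f') \<otimes> g = (f \<otimes> g) \<oplus> (f' \<otimes> g)"
    and tensor_add_right: "f \<in> hom C A A' \<Longrightarrow> g \<in> hom C B B' \<Longrightarrow> g' \<in> hom C B B' \<Longrightarrow>
      f \<otimes> (g \<oplus> g') = (f \<otimes> g) \<oplus> (f \<otimes> g')"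
    and tensor_smult_left: "f \<in> hom C A A' \<Longrightarrow> g \<in> hom C B B' \<Longrightarrow> (r \<odot> f) \<otimes> g = r \<odot> (f \<otimes> g)"
    and tensor_smult_right: "f \<in> hom C A A' \<Longrightarrow> g \<in> hom C B B' \<Longrightarrow> f \<otimes> (r \<odot> g) = r \<odot> (f \<otimes> g)"

context
  fixes C :: "('o, 'm, 'k, 'z) linear_smc_scheme" (structure)
begin

definition is_biproduct ::
  "nat \<Rightarrow> (nat \<Rightarrow> 'o) \<Rightarrow> 'o \<Rightarrow> (nat \<Rightarrow> 'm) \<Rightarrow> (nat \<Rightarrow> 'm) \<Rightarrow> bool"
  where "is_biproduct n X P p i \<longleftrightarrow>
    P \<in> obj C \<and>
    (\<forall>j<n. p j \<in> hom C P (X j) \<and> i j \<in> hom C (X j) P) \<and>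
    (\<forall>j<n. \<forall>l<n. p l \<cdot> i j = (if l = j then \<one> (X j) else \<zero> (X j) (X l))) \<and>
    (\<forall>Y \<in> obj C. \<forall>f. (\<forall>j<n. f j \<in> hom C Y (X j)) \<longrightarrow>
      (\<exists>!h. h \<in> hom C Y P \<and> (\<forall>j<n. p j \<cdot> h = f j))) \<and>
    (\<forall>Y \<in> obj C. \<forall>f. (\<forall>j<n. f j \<in> hom C (X j) Y) \<longrightarrow>
      (\<exists>!h. h \<in> hom C P Y \<and> (\<forall>j<n. h \<cdot> i j = f j)))"

definition has_finite_biproducts :: bool
  where "has_finite_biproducts \<longleftrightarrow>
    (\<forall>n X. (\<forall>j<n. X j \<in> obj C) \<longrightarrow> (\<exists>P p i. is_biproduct n X P p i))"

end


section \<open>Differential structure\<close>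

text \<open>Throughout, \<open>bang\<close> is the action of the endofunctor on objects, and \<open>d\<close>, \<open>e\<close>, \<open>\<Delta>\<close>,
  \<open>\<epsilon>\<close>, \<open>\<delta>\<close> are families of morphisms indexed by objects, none of them required to be natural.\<close>

context
  fixes C :: "('o, 'm, 'k, 'z) linear_smc_scheme" (structure)
    and bang :: "'o \<Rightarrow> 'o"
begin

definition interchange_rule :: "('o \<Rightarrow> 'm) \<Rightarrow> 'o \<Rightarrow> bool"
  where "interchange_rule d X \<longleftrightarrow>
    d X \<cdot> (d X \<otimes> \<one> X) \<cdot> inv_arr C (\<a> (bang X) X X) \<cdot> (\<one> (bang X) \<otimes> \<sigma> X X) \<cdot> \<a> (bang X) X X =
    d X \<cdot> (d X \<otimes> \<one> X)"

definition constant_rule :: "('o \<Rightarrow> 'm) \<Rightarrow> ('o \<Rightarrow> 'm) \<Rightarrow> 'o \<Rightarrow> bool"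
  where "constant_rule d e X \<longleftrightarrow> e X \<cdot> d X = \<zero> (bang X \<otimes>\<^sub>o X) I"

definition product_rule :: "('o \<Rightarrow> 'm) \<Rightarrow> ('o \<Rightarrow> 'm) \<Rightarrow> 'o \<Rightarrow> bool"
  where "product_rule d \<Delta> X \<longleftrightarrow>
    \<Delta> X \<cdot> d X =
    ((\<one> (bang X) \<otimes> d X) \<cdot> \<a> (bang X) (bang X) X \<oplus>
     (d X \<otimes> \<one> (bang X)) \<cdot> inv_arr C (\<a> (bang X) X (bang X)) \<cdot>
       (\<one> (bang X) \<otimes> \<sigma> (bang X) X) \<cdot> \<a> (bang X) (bang X) X) \<cdot>
    (\<Delta> X \<otimes> \<one> X)"

definition linear_rule :: "('o \<Rightarrow> 'm) \<Rightarrow> ('o \<Rightarrow> 'm) \<Rightarrow> ('o \<Rightarrow> 'm) \<Rightarrow> 'o \<Rightarrow> bool"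
  where "linear_rule d e \<epsilon> X \<longleftrightarrow> \<epsilon> X \<cdot> d X = \<l> X \<cdot> (e X \<otimes> \<one> X)"

definition chain_rule :: "('o \<Rightarrow> 'm) \<Rightarrow> ('o \<Rightarrow> 'm) \<Rightarrow> ('o \<Rightarrow> 'm) \<Rightarrow> 'o \<Rightarrow> bool"
  where "chain_rule d \<Delta> \<delta> X \<longleftrightarrow>
    \<delta> X \<cdot> d X =
    d (bang X) \<cdot> (\<delta> X \<otimes> d X) \<cdot> \<a> (bang X) (bang X) X \<cdot> (\<Delta> X \<otimes> \<one> X)"

definition b_map :: "('o \<Rightarrow> 'm) \<Rightarrow> ('o \<Rightarrow> 'm) \<Rightarrow> 'o \<Rightarrow> 'm"
  where "b_map \<Delta> \<epsilon> A = (\<one> (bang A) \<otimes> \<epsilon> A) \<cdot> \<Delta> A"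

definition bang_action ::
  "('o \<Rightarrow> 'm) \<Rightarrow> ('o \<Rightarrow> 'm) \<Rightarrow> ('o \<Rightarrow> 'm) \<Rightarrow> 'o \<Rightarrow> 'o \<times> 'm \<Rightarrow> 'o \<times> 'm"
  where "bang_action d \<Delta> \<epsilon> X = (\<lambda>(A, \<alpha>).
    (bang A, d A \<cdot> (\<one> (bang A) \<otimes> \<alpha>) \<cdot> \<a> (bang A) A X \<cdot> (b_map \<Delta> \<epsilon> A \<otimes> \<one> X)))"

end

end

theory Submission
  imports Defs
begin

text \<open>Composing the structure map of the action \<open>!\<^sup>X(!X, d)\<close> with \<open>\<delta> \<otimes> X\<close> gives the right-hand side
  of the chain rule: since \<open>\<delta>\<close> preserves comultiplication and \<open>\<epsilon> \<cdot> \<delta> = 1\<close>, one has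
  \<open>b \<cdot> \<delta> = (\<delta> \<otimes> 1) \<cdot> \<Delta>\<close>, where \<open>b = (1 \<otimes> \<epsilon>) \<cdot> \<Delta>\<close>
  (\<open>bang_action_after_comultiplication\<close>). So for each \<open>X\<close> the chain rule is exactly the equation that
  makes \<open>\<delta>\<close> compatible with the two actions.

  A map of actions also needs its source and target to be commuting actions. For the source this is
  the interchange rule. For the target it is the substance of the proof
  (\<open>bang_action_commuting\<close>). Let \<open>\<alpha>\<close> be a commuting \<open>X\<close>-action on \<open>A\<close> and let
  \<open>\<beta> = d \<cdot> \<alpha> \<cdot> (b \<otimes> X)\<close> be the action on \<open>!A\<close>, where \<open>\<alpha>\<close> acts on the last two of the factors
  \<open>!A, A, X\<close>. The product and linear rules give
  \<open>b \<cdot> d = 1 \<oplus> (d \<otimes> A) \<cdot> s \<cdot> (b \<otimes> A)\<close>, with \<open>s\<close> exchanging the two copies of \<open>A\<close>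
  (\<open>b_after_d\<close>). Hence \<open>\<beta> \<cdot> (\<beta> \<otimes> X)\<close> is a sum of two terms, corresponding to the second
  derivative and to the product of first derivatives of the inner function when a composite is
  differentiated twice. In the first term,
  \<open>\<alpha>\<close> acts twice on the same copy of \<open>A\<close>, and the copies of \<open>X\<close> may be exchanged because \<open>\<alpha>\<close> is
  commuting. In the second term, each of two copies of \<open>A\<close> receives one copy of \<open>X\<close>. Exchanging the
  copies of \<open>X\<close> amounts to exchanging the copies of \<open>A\<close> both before and after
  (\<open>act_twice_symmetric\<close>); the exchange before is absorbed by cocommutativity
  (\<open>b_iterated_symmetric\<close>) and the exchange after by the interchange rule.

  Coherence is kept under control by nesting all tensor products to the left, so that \<open>- \<otimes> A\<close> is a
  functor applied on the right. Only two kinds of structure map then occur: \<open>swap W P Q\<close>, which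
  exchanges the last two factors of \<open>(W \<otimes> P) \<otimes> Q\<close>, and \<open>act W A X \<alpha>\<close>, which applies \<open>\<alpha>\<close> to the last
  two factors of \<open>(W \<otimes> A) \<otimes> X\<close>. Associators are visible only in the proofs of their naturality, of
  \<open>act_swap\<close> (which uses the hexagon and pentagon) and of \<open>commuting_action_act\<close>, and where
  coassociativity and the rules for \<open>d\<close> are translated into or out of this form.\<close>


section \<open>Rewriting typed composites\<close>

text \<open>Typing conditions are phrased with \<open>arr\<close>, \<open>src\<close> and \<open>tgt\<close> instead of \<open>hom\<close>, so that the
  simplifier can discharge them by computation: the equations below leave no intermediate object to
  guess. The normal form of composites is nested to the right.\<close>

context category
begin

lemma in_hom: "f \<in> hom C A B \<longleftrightarrow> f \<in> arr C \<and> src C f = A \<and> tgt C f = B"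
  by (simp add: hom_def)

lemma ident_typing [simp]:
  assumes "A \<in> obj C"
  shows "\<one> A \<in> arr C" "src C (\<one> A) = A" "tgt C (\<one> A) = A"
  using ident_hom[OF assms] by (simp_all add: in_hom)

lemma compose_typing [simp]:
  assumes "f \<in> arr C" "g \<in> arr C" "src C g = tgt C f"
  shows "g \<cdot> f \<in> arr C" "src C (g \<cdot> f) = src C f" "tgt C (g \<cdot> f) = tgt C g"
  using compose_hom[of f "src C f" "tgt C f" g "tgt C g"] assms by (simp_all add: in_hom)

lemma compose_ident_simps [simp]:
  assumes "f \<in> arr C"
  shows "src C f = A \<Longrightarrow> f \<cdot> \<one> A = f" "tgt C f = A \<Longrightarrow> \<one> A \<cdot> f = f"
  using compose_ident[of f] ident_compose[of f] assms by (simp_all add: in_hom)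

lemma comp_assoc:
  assumes "f \<in> arr C" "g \<in> arr C" "h \<in> arr C" "src C g = tgt C f" "src C h = tgt C g"
  shows "(h \<cdot> g) \<cdot> f = h \<cdot> (g \<cdot> f)"
  using compose_assoc[of f "src C f" "tgt C f" g "tgt C g" h "tgt C h"] assms
  by (simp add: in_hom)

text \<open>Turns an equation for a composite of two arrows into a rewrite rule that applies inside a
  right-nested chain.\<close>

lemma comp_reassoc:
  assumes "p \<cdot> q = r"
    and "p \<in> arr C" "q \<in> arr C" "src C p = tgt C q" "f \<in> arr C" "src C q = tgt C f"
  shows "p \<cdot> (q \<cdot> f) = r \<cdot> f"
  using assms comp_assoc by metis

lemma inv_arr_inverse:
  assumes "iso C f"
  shows "inverse_arrows C f (inv_arr C f)"
proof -
  obtain g where g: "inverse_arrows C f g"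
    using assms by (auto simp: iso_def)
  have "h = g" if h: "inverse_arrows C f h" for h
  proof -
    have "h = h \<cdot> (f \<cdot> g)"
      using g h by (simp add: inverse_arrows_def in_hom)
    also have "\<dots> = (h \<cdot> f) \<cdot> g"
      using g h by (intro comp_assoc[symmetric]) (auto simp: inverse_arrows_def in_hom)
    also have "\<dots> = g"
      using g h by (simp add: inverse_arrows_def in_hom)
    finally show ?thesis .
  qed
  then show ?thesis
    unfolding inv_arr_def using g by (rule_tac theI) auto
qed

end


section \<open>Left-nested tensor products\<close>

context symmetric_monoidal_category
begin

declare src_obj [simp] tgt_obj [simp] tensor_obj [simp] unit_obj [simp]
  tensor_ident [simp] symmetry_involution [simp]

lemma tensor_typing [simp]:
  assumes "f \<in> arr C" "g \<in> arr C"
  shows "f \<otimes> g \<in> arr C" "src C (f \<otimes> g) = src C f \<otimes>\<^sub>o src C g"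
    "tgt C (f \<otimes> g) = tgt C f \<otimes>\<^sub>o tgt C g"
  using tensor_hom[of f "src C f" "tgt C f" g "src C g" "tgt C g"] assms
  by (simp_all add: in_hom)

lemma structure_typing [simp]:
  assumes "A \<in> obj C"
  shows "\<l> A \<in> arr C" "src C (\<l> A) = I \<otimes>\<^sub>o A" "tgt C (\<l> A) = A"
    "\<r> A \<in> arr C" "src C (\<r> A) = A \<otimes>\<^sub>o I" "tgt C (\<r> A) = A"
    "B \<in> obj C \<Longrightarrow> \<sigma> A B \<in> arr C"
    "B \<in> obj C \<Longrightarrow> src C (\<sigma> A B) = A \<otimes>\<^sub>o B"
    "B \<in> obj C \<Longrightarrow> tgt C (\<sigma> A B) = B \<otimes>\<^sub>o A"
    "B \<in> obj C \<Longrightarrow> D \<in> obj C \<Longrightarrow> \<a> A B D \<in> arr C"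
    "B \<in> obj C \<Longrightarrow> D \<in> obj C \<Longrightarrow> src C (\<a> A B D) = (A \<otimes>\<^sub>o B) \<otimes>\<^sub>o D"
    "B \<in> obj C \<Longrightarrow> D \<in> obj C \<Longrightarrow> tgt C (\<a> A B D) = A \<otimes>\<^sub>o (B \<otimes>\<^sub>o D)"
  using left_unitor_hom[OF assms] right_unitor_hom[OF assms] symmetry_hom[OF assms, of B]
    associator_hom[OF assms, of B D]
  by (simp_all add: in_hom)

lemma inv_associator [simp]:
  assumes "A \<in> obj C" "B \<in> obj C" "D \<in> obj C"
  shows "inv_arr C (\<a> A B D) \<in> arr C"
    "src C (inv_arr C (\<a> A B D)) = A \<otimes>\<^sub>o (B \<otimes>\<^sub>o D)"
    "tgt C (inv_arr C (\<a> A B D)) = (A \<otimes>\<^sub>o B) \<otimes>\<^sub>o D"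
    "\<a> A B D \<cdot> inv_arr C (\<a> A B D) = \<one> (A \<otimes>\<^sub>o (B \<otimes>\<^sub>o D))"
    "inv_arr C (\<a> A B D) \<cdot> \<a> A B D = \<one> ((A \<otimes>\<^sub>o B) \<otimes>\<^sub>o D)"
  using inv_arr_inverse[OF associator_iso[OF assms]] assms
  by (auto simp: inverse_arrows_def in_hom)

lemma inv_associator_cancel [simp]:
  assumes "A \<in> obj C" "B \<in> obj C" "D \<in> obj C" "f \<in> arr C"
  shows "tgt C f = A \<otimes>\<^sub>o (B \<otimes>\<^sub>o D) \<Longrightarrow> \<a> A B D \<cdot> (inv_arr C (\<a> A B D) \<cdot> f) = f"
    "tgt C f = (A \<otimes>\<^sub>o B) \<otimes>\<^sub>o D \<Longrightarrow> inv_arr C (\<a> A B D) \<cdot> (\<a> A B D \<cdot> f) = f"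
  using assms by (simp_all add: comp_assoc[symmetric])

lemma tensor_compose_merge:
  assumes "f \<in> arr C" "f' \<in> arr C" "g \<in> arr C" "g' \<in> arr C"
    "src C f' = tgt C f" "src C g' = tgt C g"
  shows "(f' \<otimes> g') \<cdot> (f \<otimes> g) = (f' \<cdot> f) \<otimes> (g' \<cdot> g)"
    "h \<in> arr C \<Longrightarrow> tgt C h = src C f \<otimes>\<^sub>o src C g \<Longrightarrow>
      (f' \<otimes> g') \<cdot> ((f \<otimes> g) \<cdot> h) = ((f' \<cdot> f) \<otimes> (g' \<cdot> g)) \<cdot> h"
proof -
  show *: "(f' \<otimes> g') \<cdot> (f \<otimes> g) = (f' \<cdot> f) \<otimes> (g' \<cdot> g)"
    using tensor_compose[of f "src C f" "tgt C f" f' "tgt C f'" g "src C g" "tgt C g" g' "tgt C g'"]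
      assms by (simp add: in_hom)
  show "(f' \<otimes> g') \<cdot> ((f \<otimes> g) \<cdot> h) = ((f' \<cdot> f) \<otimes> (g' \<cdot> g)) \<cdot> h"
    if "h \<in> arr C" "tgt C h = src C f \<otimes>\<^sub>o src C g"
    using that assms by (subst comp_reassoc[OF *]) simp_all
qed

lemma associator_nat:
  assumes "f \<in> arr C" "g \<in> arr C" "h \<in> arr C" "tgt C f = A" "tgt C g = B" "tgt C h = D"
  shows "\<a> A B D \<cdot> ((f \<otimes> g) \<otimes> h) =
      (f \<otimes> (g \<otimes> h)) \<cdot> \<a> (src C f) (src C g) (src C h)"
  using assms associator_natural[of f "src C f" A g "src C g" B h "src C h" D]
  by (simp add: in_hom)

lemma associator_nat_ident:
  assumes "A \<in> obj C" "B \<in> obj C" "h \<in> arr C" "tgt C h = D"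
  shows "\<a> A B D \<cdot> (\<one> (A \<otimes>\<^sub>o B) \<otimes> h) = (\<one> A \<otimes> (\<one> B \<otimes> h)) \<cdot> \<a> A B (src C h)"
  using assms associator_nat[of "\<one> A" "\<one> B" h A B D] by simp

lemma inv_associator_nat:
  assumes "f \<in> arr C" "g \<in> arr C" "h \<in> arr C" "tgt C f = A" "tgt C g = B" "tgt C h = D"
  shows "inv_arr C (\<a> A B D) \<cdot> (f \<otimes> (g \<otimes> h)) =
      ((f \<otimes> g) \<otimes> h) \<cdot> inv_arr C (\<a> (src C f) (src C g) (src C h))"
proof -
  have [simp]: "A \<in> obj C" "B \<in> obj C" "D \<in> obj C" using assms by auto
  have "inv_arr C (\<a> A B D) \<cdot> ((\<a> A B D \<cdot> ((f \<otimes> g) \<otimes> h)) \<cdot> inv_arr C (\<a> (src C f) (src C g) (src C h)))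
    = inv_arr C (\<a> A B D) \<cdot> (((f \<otimes> (g \<otimes> h)) \<cdot> \<a> (src C f) (src C g) (src C h)) \<cdot> inv_arr C (\<a> (src C f) (src C g) (src C h)))"
    by (simp only: associator_nat[OF assms])
  then show ?thesis using assms by (simp add: comp_assoc)
qed

lemma symmetry_nat:
  assumes "f \<in> arr C" "g \<in> arr C" "tgt C f = A" "tgt C g = B"
  shows "\<sigma> A B \<cdot> (f \<otimes> g) = (g \<otimes> f) \<cdot> \<sigma> (src C f) (src C g)"
  using assms symmetry_natural[of f "src C f" A g "src C g" B]
  by (simp add: in_hom)

definition swap :: "'o \<Rightarrow> 'o \<Rightarrow> 'o \<Rightarrow> 'm"
  where "swap W P Q = inv_arr C (\<a> W Q P) \<cdot> (\<one> W \<otimes> \<sigma> P Q) \<cdot> \<a> W P Q"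

definition act :: "'o \<Rightarrow> 'o \<Rightarrow> 'o \<Rightarrow> 'm \<Rightarrow> 'm"
  where "act W A X \<alpha> = (\<one> W \<otimes> \<alpha>) \<cdot> \<a> W A X"

lemma swap_typing [simp]:
  assumes "W \<in> obj C" "P \<in> obj C" "Q \<in> obj C"
  shows "swap W P Q \<in> arr C" "src C (swap W P Q) = (W \<otimes>\<^sub>o P) \<otimes>\<^sub>o Q"
    "tgt C (swap W P Q) = (W \<otimes>\<^sub>o Q) \<otimes>\<^sub>o P"
  using assms by (simp_all add: swap_def)

lemma act_typing [simp]:
  assumes "W \<in> obj C" "A \<in> obj C" "X \<in> obj C" "f \<in> arr C" "src C f = A \<otimes>\<^sub>o X"
  shows "act W A X f \<in> arr C" "src C (act W A X f) = (W \<otimes>\<^sub>o A) \<otimes>\<^sub>o X"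
    "tgt C (act W A X f) = W \<otimes>\<^sub>o tgt C f"
  using assms by (simp_all add: act_def)

lemma associator_swap:
  assumes "W \<in> obj C" "P \<in> obj C" "Q \<in> obj C"
  shows "\<a> W Q P \<cdot> swap W P Q = (\<one> W \<otimes> \<sigma> P Q) \<cdot> \<a> W P Q"
  using assms by (simp add: swap_def comp_assoc)

lemma swap_swap:
  assumes "W \<in> obj C" "P \<in> obj C" "Q \<in> obj C"
  shows "swap W Q P \<cdot> swap W P Q = \<one> ((W \<otimes>\<^sub>o P) \<otimes>\<^sub>o Q)"
  using assms by (simp add: swap_def comp_assoc tensor_compose_merge)

lemma swap_nat:
  assumes "f \<in> arr C" "p \<in> arr C" "q \<in> arr C" "tgt C f = W" "tgt C p = P" "tgt C q = Q"
  shows "swap W P Q \<cdot> ((f \<otimes> p) \<otimes> q) = ((f \<otimes> q) \<otimes> p) \<cdot> swap (src C f) (src C p) (src C q)"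
proof -
  have [simp]: "W \<in> obj C" "P \<in> obj C" "Q \<in> obj C" using assms by auto
  have push: "((f \<otimes> q) \<otimes> p) \<cdot> inv_arr C (\<a> (src C f) (src C q) (src C p)) =
      inv_arr C (\<a> W Q P) \<cdot> (f \<otimes> (q \<otimes> p))"
    using assms by (simp add: inv_associator_nat)
  show ?thesis
    using assms
    by (simp add: swap_def comp_assoc associator_nat tensor_compose_merge symmetry_nat comp_reassoc[OF push])
qed


lemma act_nat:
  assumes "f \<in> arr C" "tgt C f = W" "A \<in> obj C" "X \<in> obj C" "\<alpha> \<in> arr C" "src C \<alpha> = A \<otimes>\<^sub>o X"
  shows "act W A X \<alpha> \<cdot> ((f \<otimes> \<one> A) \<otimes> \<one> X) = (f \<otimes> \<one> (tgt C \<alpha>)) \<cdot> act (src C f) A X \<alpha>"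
proof -
  have [simp]: "W \<in> obj C" using assms by auto
  show ?thesis
    using assms by (simp add: act_def comp_assoc associator_nat tensor_compose_merge)
qed

lemma pentagon_right_nested:
  assumes "A \<in> obj C" "B \<in> obj C" "D \<in> obj C" "E \<in> obj C"
  shows "(\<one> A \<otimes> \<a> B D E) \<cdot> (\<a> A (B \<otimes>\<^sub>o D) E \<cdot> (\<a> A B D \<otimes> \<one> E)) =
      \<a> A B (D \<otimes>\<^sub>o E) \<cdot> \<a> (A \<otimes>\<^sub>o B) D E"
  using pentagon[OF assms] assms by (simp add: comp_assoc)

lemma cancel_left:
  assumes "g \<cdot> f = \<one> B" "f \<in> arr C" "g \<in> arr C" "src C f = B" "tgt C f = src C g"
    and "f \<cdot> x = f \<cdot> y" "x \<in> arr C" "y \<in> arr C" "tgt C x = B" "tgt C y = B"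
  shows "x = y"
proof -
  have "z = g \<cdot> (f \<cdot> z)" if "z \<in> arr C" "tgt C z = B" for z
    using comp_reassoc[OF assms(1), of z] that assms(2-5) by (metis compose_ident_simps(2))
  then show ?thesis using assms by metis
qed

lemma cancel_associator:
  assumes "\<a> A B D \<cdot> x = \<a> A B D \<cdot> y" "A \<in> obj C" "B \<in> obj C" "D \<in> obj C"
    and "x \<in> arr C" "y \<in> arr C" "tgt C x = (A \<otimes>\<^sub>o B) \<otimes>\<^sub>o D" "tgt C y = (A \<otimes>\<^sub>o B) \<otimes>\<^sub>o D"
  shows "x = y"
  by (rule cancel_left[of "inv_arr C (\<a> A B D)" "\<a> A B D"]) (use assms in simp_all)

lemma cancel_ident_associator:
  assumes "(\<one> W \<otimes> \<a> A B D) \<cdot> x = (\<one> W \<otimes> \<a> A B D) \<cdot> y"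
    and "W \<in> obj C" "A \<in> obj C" "B \<in> obj C" "D \<in> obj C"
    and "x \<in> arr C" "y \<in> arr C" "tgt C x = W \<otimes>\<^sub>o ((A \<otimes>\<^sub>o B) \<otimes>\<^sub>o D)"
    "tgt C y = W \<otimes>\<^sub>o ((A \<otimes>\<^sub>o B) \<otimes>\<^sub>o D)"
  shows "x = y"
  by (rule cancel_left[of "\<one> W \<otimes> inv_arr C (\<a> A B D)" "\<one> W \<otimes> \<a> A B D"])
    (use assms in \<open>simp_all add: tensor_compose_merge\<close>)

text \<open>The hexagon in the presence of an inert left factor \<open>W\<close>: exchanging \<open>A\<close> with the pair
  \<open>P \<otimes> X\<close> is exchanging it with \<open>P\<close> and then with \<open>X\<close>. Both sides become equal to the same composite
  after two associators, which carry the target to the form in which the hexagon is stated.\<close>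

lemma swap_past_pair:
  assumes [simp]: "W \<in> obj C" "A \<in> obj C" "P \<in> obj C" "X \<in> obj C"
  shows "swap W A (P \<otimes>\<^sub>o X) \<cdot> \<a> (W \<otimes>\<^sub>o A) P X =
      (\<a> W P X \<otimes> \<one> A) \<cdot> (swap (W \<otimes>\<^sub>o P) A X \<cdot> (swap W A P \<otimes> \<one> X))" (is "?L = ?R")
proof -
  have hex: "\<a> P X A \<cdot> (\<sigma> A (P \<otimes>\<^sub>o X) \<cdot> \<a> A P X) =
      (\<one> P \<otimes> \<sigma> A X) \<cdot> (\<a> P A X \<cdot> (\<sigma> A P \<otimes> \<one> X))"
    using hexagon[of A P X] by (simp add: comp_assoc)
  define T where "T = (\<one> W \<otimes> ((\<one> P \<otimes> \<sigma> A X) \<cdot> (\<a> P A X \<cdot> (\<sigma> A P \<otimes> \<one> X)))) \<cdot>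
    (\<a> W (A \<otimes>\<^sub>o P) X \<cdot> (\<a> W A P \<otimes> \<one> X))"
  have "(\<one> W \<otimes> \<a> P X A) \<cdot> (\<a> W (P \<otimes>\<^sub>o X) A \<cdot> ?L) =
      (\<one> W \<otimes> (\<a> P X A \<cdot> \<sigma> A (P \<otimes>\<^sub>o X))) \<cdot> (\<a> W A (P \<otimes>\<^sub>o X) \<cdot> \<a> (W \<otimes>\<^sub>o A) P X)"
    by (simp add: comp_reassoc[OF associator_swap] comp_assoc tensor_compose_merge)
  also have "\<dots> = T"
    by (simp add: pentagon_right_nested[symmetric] tensor_compose_merge comp_assoc hex T_def)
  finally have L: "(\<one> W \<otimes> \<a> P X A) \<cdot> (\<a> W (P \<otimes>\<^sub>o X) A \<cdot> ?L) = T" .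
  have "(\<one> W \<otimes> \<a> P X A) \<cdot> (\<a> W (P \<otimes>\<^sub>o X) A \<cdot> ?R) =
      ((\<one> W \<otimes> \<a> P X A) \<cdot> (\<a> W (P \<otimes>\<^sub>o X) A \<cdot> (\<a> W P X \<otimes> \<one> A))) \<cdot>
        (swap (W \<otimes>\<^sub>o P) A X \<cdot> (swap W A P \<otimes> \<one> X))"
    by (simp add: comp_assoc)
  also have "\<dots> = \<a> W P (X \<otimes>\<^sub>o A) \<cdot> ((\<one> (W \<otimes>\<^sub>o P) \<otimes> \<sigma> A X) \<cdot>
      (\<a> (W \<otimes>\<^sub>o P) A X \<cdot> (swap W A P \<otimes> \<one> X)))"
    by (simp add: pentagon_right_nested comp_assoc comp_reassoc[OF associator_swap])
  also have "\<dots> = (\<one> W \<otimes> (\<one> P \<otimes> \<sigma> A X)) \<cdot>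
      ((\<a> W P (A \<otimes>\<^sub>o X) \<cdot> \<a> (W \<otimes>\<^sub>o P) A X) \<cdot> (swap W A P \<otimes> \<one> X))"
    by (simp add: comp_reassoc[OF associator_nat_ident] comp_assoc)
  also have "\<dots> = (\<one> W \<otimes> (\<one> P \<otimes> \<sigma> A X)) \<cdot>
      ((\<one> W \<otimes> \<a> P A X) \<cdot> (\<a> W (P \<otimes>\<^sub>o A) X \<cdot> ((\<a> W P A \<cdot> swap W A P) \<otimes> \<one> X)))"
    by (simp add: pentagon_right_nested[symmetric] comp_assoc tensor_compose_merge)
  also have "\<dots> = (\<one> W \<otimes> (\<one> P \<otimes> \<sigma> A X)) \<cdot> ((\<one> W \<otimes> \<a> P A X) \<cdot>
      (\<a> W (P \<otimes>\<^sub>o A) X \<cdot> (((\<one> W \<otimes> \<sigma> A P) \<otimes> \<one> X) \<cdot> (\<a> W A P \<otimes> \<one> X))))"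
    by (simp add: associator_swap tensor_compose_merge)
  also have "\<dots> = T"
    by (subst comp_reassoc[OF associator_nat]) (simp_all add: comp_assoc tensor_compose_merge T_def)
  finally have "(\<one> W \<otimes> \<a> P X A) \<cdot> (\<a> W (P \<otimes>\<^sub>o X) A \<cdot> ?L) =
      (\<one> W \<otimes> \<a> P X A) \<cdot> (\<a> W (P \<otimes>\<^sub>o X) A \<cdot> ?R)"
    using L by simp
  then have "\<a> W (P \<otimes>\<^sub>o X) A \<cdot> ?L = \<a> W (P \<otimes>\<^sub>o X) A \<cdot> ?R"
    by (rule cancel_ident_associator) simp_all
  then show ?thesis
    by (rule cancel_associator) simp_all
qed

text \<open>To let \<open>g\<close> act to the right of \<open>A\<close> and then move \<open>A\<close> to the end is to move \<open>A\<close> past both inputs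
  of \<open>g\<close> first.\<close>

lemma act_swap:
  assumes [simp]: "W \<in> obj C" "A \<in> obj C" "P \<in> obj C" "X \<in> obj C" "g \<in> arr C"
    "src C g = P \<otimes>\<^sub>o X" "tgt C g = Q"
  shows "swap W A Q \<cdot> act (W \<otimes>\<^sub>o A) P X g =
      (act W P X g \<otimes> \<one> A) \<cdot> (swap (W \<otimes>\<^sub>o P) A X \<cdot> (swap W A P \<otimes> \<one> X))"
proof -
  have [simp]: "Q \<in> obj C" using tgt_obj[of g] by simp
  have "swap W A Q \<cdot> ((\<one> W \<otimes> \<one> A) \<otimes> g) = ((\<one> W \<otimes> g) \<otimes> \<one> A) \<cdot> swap W A (P \<otimes>\<^sub>o X)"
    by (subst swap_nat) simp_all
  then have nat: "swap W A Q \<cdot> (\<one> (W \<otimes>\<^sub>o A) \<otimes> g) = ((\<one> W \<otimes> g) \<otimes> \<one> A) \<cdot> swap W A (P \<otimes>\<^sub>o X)"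
    by simp
  show ?thesis
    by (simp add: act_def comp_reassoc[OF nat] comp_assoc swap_past_pair tensor_compose_merge)
qed

text \<open>The mirror image of \<open>act_swap\<close>, which follows because \<open>swap W A P\<close> and \<open>swap W P A\<close> are mutually
  inverse.\<close>

lemma act_swap_left:
  assumes [simp]: "W \<in> obj C" "A \<in> obj C" "P \<in> obj C" "X \<in> obj C" "g \<in> arr C"
    "src C g = P \<otimes>\<^sub>o X" "tgt C g = Q"
  shows "swap W Q A \<cdot> (act W P X g \<otimes> \<one> A) =
      act (W \<otimes>\<^sub>o A) P X g \<cdot> ((swap W P A \<otimes> \<one> X) \<cdot> swap (W \<otimes>\<^sub>o P) X A)"
proof -
  have [simp]: "Q \<in> obj C" using tgt_obj[of g] by simp
  have "(act W P X g \<otimes> \<one> A) = (act W P X g \<otimes> \<one> A) \<cdot> (swap (W \<otimes>\<^sub>o P) A X \<cdot>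
      (((swap W A P \<otimes> \<one> X) \<cdot> (swap W P A \<otimes> \<one> X)) \<cdot> swap (W \<otimes>\<^sub>o P) X A))"
    by (simp add: tensor_compose_merge swap_swap)
  also have "\<dots> = (swap W A Q \<cdot> act (W \<otimes>\<^sub>o A) P X g) \<cdot>
      ((swap W P A \<otimes> \<one> X) \<cdot> swap (W \<otimes>\<^sub>o P) X A)"
    by (simp only: act_swap[OF assms]) (simp add: comp_assoc)
  finally show ?thesis
    by (simp add: comp_assoc comp_reassoc[OF swap_swap])
qed

text \<open>The commuting law transported from \<open>\<alpha>\<close> on \<open>A\<close> to \<open>act W A X \<alpha>\<close> on \<open>W \<otimes> A\<close>, along the
  reassociation \<open>K\<close> that splits off \<open>W\<close>.\<close>

lemma commuting_action_act:
  assumes "commuting_action C X (A, \<alpha>)" and [simp]: "W \<in> obj C" "X \<in> obj C"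
  shows "act W A X \<alpha> \<cdot> ((act W A X \<alpha> \<otimes> \<one> X) \<cdot> swap (W \<otimes>\<^sub>o A) X X) =
      act W A X \<alpha> \<cdot> (act W A X \<alpha> \<otimes> \<one> X)"
proof -
  have [simp]: "A \<in> obj C" "\<alpha> \<in> arr C" "src C \<alpha> = A \<otimes>\<^sub>o X" "tgt C \<alpha> = A"
    using assms by (auto simp: commuting_action_def in_hom)
  have comm: "\<alpha> \<cdot> ((\<alpha> \<otimes> \<one> X) \<cdot> swap A X X) = \<alpha> \<cdot> (\<alpha> \<otimes> \<one> X)"
    using assms(1) by (simp add: commuting_action_def swap_def comp_assoc)
  define K where "K = \<a> W (A \<otimes>\<^sub>o X) X \<cdot> (\<a> W A X \<otimes> \<one> X)"
  have [simp]: "K \<in> arr C" "src C K = ((W \<otimes>\<^sub>o A) \<otimes>\<^sub>o X) \<otimes>\<^sub>o X"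
    "tgt C K = W \<otimes>\<^sub>o ((A \<otimes>\<^sub>o X) \<otimes>\<^sub>o X)"
    by (simp_all add: K_def)
  have pent: "(\<one> W \<otimes> \<a> A X X) \<cdot> K = \<a> W A (X \<otimes>\<^sub>o X) \<cdot> \<a> (W \<otimes>\<^sub>o A) X X"
    unfolding K_def by (simp add: pentagon_right_nested)
  have "(\<one> W \<otimes> \<a> A X X) \<cdot> (K \<cdot> swap (W \<otimes>\<^sub>o A) X X) =
      (\<one> W \<otimes> (\<one> A \<otimes> \<sigma> X X)) \<cdot> (\<a> W A (X \<otimes>\<^sub>o X) \<cdot> \<a> (W \<otimes>\<^sub>o A) X X)"
    by (simp add: comp_reassoc[OF pent] comp_assoc associator_swap comp_reassoc[OF associator_nat_ident])
  also have "\<dots> = (\<one> W \<otimes> \<a> A X X) \<cdot> ((\<one> W \<otimes> swap A X X) \<cdot> K)"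
    by (simp add: pent[symmetric] tensor_compose_merge associator_swap)
  finally have K_swap: "K \<cdot> swap (W \<otimes>\<^sub>o A) X X = (\<one> W \<otimes> swap A X X) \<cdot> K"
    by (rule cancel_ident_associator) simp_all
  have K_act: "act W A X \<alpha> \<cdot> (act W A X \<alpha> \<otimes> \<one> X) = (\<one> W \<otimes> (\<alpha> \<cdot> (\<alpha> \<otimes> \<one> X))) \<cdot> K"
  proof -
    have "act W A X \<alpha> \<cdot> (act W A X \<alpha> \<otimes> \<one> X) =
        (\<one> W \<otimes> \<alpha>) \<cdot> (\<a> W A X \<cdot> (((\<one> W \<otimes> \<alpha>) \<otimes> \<one> X) \<cdot> (\<a> W A X \<otimes> \<one> X)))"
      by (simp add: act_def comp_assoc tensor_compose_merge)
    also have "\<dots> = (\<one> W \<otimes> (\<alpha> \<cdot> (\<alpha> \<otimes> \<one> X))) \<cdot> K"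
      by (subst comp_reassoc[OF associator_nat]) (simp_all add: comp_assoc tensor_compose_merge K_def)
    finally show ?thesis .
  qed
  have "act W A X \<alpha> \<cdot> ((act W A X \<alpha> \<otimes> \<one> X) \<cdot> swap (W \<otimes>\<^sub>o A) X X) =
      (\<one> W \<otimes> (\<alpha> \<cdot> (\<alpha> \<otimes> \<one> X))) \<cdot> (K \<cdot> swap (W \<otimes>\<^sub>o A) X X)"
    by (simp add: comp_reassoc[OF K_act] comp_assoc)
  also have "\<dots> = (\<one> W \<otimes> (\<alpha> \<cdot> (\<alpha> \<otimes> \<one> X))) \<cdot> K"
    by (simp add: K_swap tensor_compose_merge comp_assoc comm)
  finally show ?thesis by (simp add: K_act)
qed


text \<open>Here \<open>Y\<close> sends factors \<open>W, A, A, X, X\<close> to \<open>W, A, A\<close>: each \<open>A\<close> is acted on by one \<open>X\<close>. Which \<open>X\<close> meets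
  which \<open>A\<close> changes when the two \<open>X\<close> are exchanged, and this can be undone by relabelling the two \<open>A\<close>
  before and after. The proof only moves factors past \<open>\<alpha>\<close>, with \<open>act_swap\<close> and \<open>act_swap_left\<close>.\<close>

lemma act_twice_symmetric:
  assumes [simp]: "W \<in> obj C" "A \<in> obj C" "X \<in> obj C" "\<alpha> \<in> arr C"
    "src C \<alpha> = A \<otimes>\<^sub>o X" "tgt C \<alpha> = A"
  defines "Y \<equiv> act (W \<otimes>\<^sub>o A) A X \<alpha> \<cdot>
    ((swap W A A \<otimes> \<one> X) \<cdot> (act (W \<otimes>\<^sub>o A) A X \<alpha> \<otimes> \<one> X))"
  shows "Y \<cdot> swap ((W \<otimes>\<^sub>o A) \<otimes>\<^sub>o A) X X =
    swap W A A \<cdot> (Y \<cdot> ((swap W A A \<otimes> \<one> X) \<otimes> \<one> X))"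
proof -
  define s where "s = swap W A A"
  define t where "t = swap (W \<otimes>\<^sub>o A) A X"
  define r where "r = swap (W \<otimes>\<^sub>o A) X A"
  define u where "u = swap ((W \<otimes>\<^sub>o A) \<otimes>\<^sub>o A) X X"
  define p where "p = act W A X \<alpha>"
  define q where "q = act (W \<otimes>\<^sub>o A) A X \<alpha>"
  have [simp]: "s \<in> arr C" "src C s = (W \<otimes>\<^sub>o A) \<otimes>\<^sub>o A" "tgt C s = (W \<otimes>\<^sub>o A) \<otimes>\<^sub>o A"
    by (simp_all add: s_def)
  have [simp]: "t \<in> arr C" "src C t = ((W \<otimes>\<^sub>o A) \<otimes>\<^sub>o A) \<otimes>\<^sub>o X"
    "tgt C t = ((W \<otimes>\<^sub>o A) \<otimes>\<^sub>o X) \<otimes>\<^sub>o A"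
    by (simp_all add: t_def)
  have [simp]: "r \<in> arr C" "src C r = ((W \<otimes>\<^sub>o A) \<otimes>\<^sub>o X) \<otimes>\<^sub>o A"
    "tgt C r = ((W \<otimes>\<^sub>o A) \<otimes>\<^sub>o A) \<otimes>\<^sub>o X"
    by (simp_all add: r_def)
  have [simp]: "u \<in> arr C" "src C u = (((W \<otimes>\<^sub>o A) \<otimes>\<^sub>o A) \<otimes>\<^sub>o X) \<otimes>\<^sub>o X"
    "tgt C u = (((W \<otimes>\<^sub>o A) \<otimes>\<^sub>o A) \<otimes>\<^sub>o X) \<otimes>\<^sub>o X"
    by (simp_all add: u_def)
  have [simp]: "p \<in> arr C" "src C p = (W \<otimes>\<^sub>o A) \<otimes>\<^sub>o X" "tgt C p = W \<otimes>\<^sub>o A"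
    by (simp_all add: p_def)
  have [simp]: "q \<in> arr C" "src C q = ((W \<otimes>\<^sub>o A) \<otimes>\<^sub>o A) \<otimes>\<^sub>o X"
    "tgt C q = (W \<otimes>\<^sub>o A) \<otimes>\<^sub>o A"
    by (simp_all add: q_def)
  have Y: "Y = q \<cdot> ((s \<otimes> \<one> X) \<cdot> (q \<otimes> \<one> X))"
    by (simp add: Y_def s_def q_def)
  define Z where "Z = q \<cdot> (((p \<otimes> \<one> A) \<otimes> \<one> X) \<cdot> (t \<otimes> \<one> X))"
  have [simp]: "Z \<in> arr C" "src C Z = (((W \<otimes>\<^sub>o A) \<otimes>\<^sub>o A) \<otimes>\<^sub>o X) \<otimes>\<^sub>o X"
    "tgt C Z = (W \<otimes>\<^sub>o A) \<otimes>\<^sub>o A"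
    by (simp_all add: Z_def)
  have sq: "s \<cdot> q = (p \<otimes> \<one> A) \<cdot> (t \<cdot> (s \<otimes> \<one> X))"
    by (simp add: s_def q_def p_def t_def act_swap)
  have sp: "s \<cdot> (p \<otimes> \<one> A) = q \<cdot> ((s \<otimes> \<one> X) \<cdot> r)"
    by (simp add: s_def q_def p_def r_def act_swap_left)
  have tq: "t \<cdot> (q \<otimes> \<one> X) = act ((W \<otimes>\<^sub>o A) \<otimes>\<^sub>o X) A X \<alpha> \<cdot> ((t \<otimes> \<one> X) \<cdot> u)"
    by (simp add: t_def q_def u_def act_swap_left)
  have ss: "s \<cdot> s = \<one> ((W \<otimes>\<^sub>o A) \<otimes>\<^sub>o A)" and rt: "r \<cdot> t = \<one> (((W \<otimes>\<^sub>o A) \<otimes>\<^sub>o A) \<otimes>\<^sub>o X)"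
    by (simp_all add: s_def r_def t_def swap_swap)
  have us: "u \<cdot> ((s \<otimes> \<one> X) \<otimes> \<one> X) = ((s \<otimes> \<one> X) \<otimes> \<one> X) \<cdot> u"
    unfolding u_def by (subst swap_nat) simp_all
  have pq: "(p \<otimes> \<one> A) \<cdot> act ((W \<otimes>\<^sub>o A) \<otimes>\<^sub>o X) A X \<alpha> = q \<cdot> ((p \<otimes> \<one> A) \<otimes> \<one> X)"
    unfolding q_def by (subst act_nat) simp_all
  \<comment> \<open>With the initial exchange of the two \<open>A\<close> factored out of \<open>Y\<close>, the claim becomes
    an equation between \<open>s \<cdot> Z\<close> and \<open>Z\<close> after the exchange of both pairs.\<close>
  have YZ: "Y = Z \<cdot> ((s \<otimes> \<one> X) \<otimes> \<one> X)"
    by (simp add: Y Z_def tensor_compose_merge sq comp_assoc)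
  have "s \<cdot> Z = (s \<cdot> q) \<cdot> (((p \<otimes> \<one> A) \<otimes> \<one> X) \<cdot> (t \<otimes> \<one> X))"
    by (simp add: Z_def comp_assoc)
  also have "\<dots> = (p \<otimes> \<one> A) \<cdot> (t \<cdot> (((s \<cdot> (p \<otimes> \<one> A)) \<cdot> t) \<otimes> \<one> X))"
    by (simp add: sq comp_assoc tensor_compose_merge)
  also have "(s \<cdot> (p \<otimes> \<one> A)) \<cdot> t = q \<cdot> (s \<otimes> \<one> X)"
    by (simp add: sp comp_assoc rt)
  also have "(p \<otimes> \<one> A) \<cdot> (t \<cdot> ((q \<cdot> (s \<otimes> \<one> X)) \<otimes> \<one> X)) =
      (p \<otimes> \<one> A) \<cdot> ((t \<cdot> (q \<otimes> \<one> X)) \<cdot> ((s \<otimes> \<one> X) \<otimes> \<one> X))"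
    by (simp add: comp_assoc tensor_compose_merge)
  also have "\<dots> = Z \<cdot> (u \<cdot> ((s \<otimes> \<one> X) \<otimes> \<one> X))"
    by (simp add: tq comp_assoc comp_reassoc[OF pq] Z_def)
  finally have sZ: "s \<cdot> Z = Z \<cdot> (u \<cdot> ((s \<otimes> \<one> X) \<otimes> \<one> X))" .
  have "Y \<cdot> u = s \<cdot> Z"
    by (simp add: YZ sZ us comp_assoc)
  also have "\<dots> = s \<cdot> (Y \<cdot> ((s \<otimes> \<one> X) \<otimes> \<one> X))"
    by (simp add: YZ comp_assoc tensor_compose_merge ss)
  finally show ?thesis by (simp add: s_def u_def)
qed


section \<open>Symmetry of the iterated comultiplication\<close>

text \<open>Coassociativity moves the second comultiplication under the last two outputs, where
  cocommutativity applies.\<close>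

lemma cocommutative_iterated_symmetric:
  assumes "cocommutative_comonoid C B \<Delta> e"
  shows "swap B B B \<cdot> ((\<Delta> \<otimes> \<one> B) \<cdot> \<Delta>) = (\<Delta> \<otimes> \<one> B) \<cdot> \<Delta>"
proof -
  have [simp]: "B \<in> obj C" "\<Delta> \<in> arr C" "src C \<Delta> = B" "tgt C \<Delta> = B \<otimes>\<^sub>o B"
    and coassoc: "\<a> B B B \<cdot> ((\<Delta> \<otimes> \<one> B) \<cdot> \<Delta>) = (\<one> B \<otimes> \<Delta>) \<cdot> \<Delta>"
    and cocomm: "\<sigma> B B \<cdot> \<Delta> = \<Delta>"
    using assms by (auto simp: cocommutative_comonoid_def in_hom comp_assoc)
  have "swap B B B \<cdot> ((\<Delta> \<otimes> \<one> B) \<cdot> \<Delta>) = inv_arr C (\<a> B B B) \<cdot> ((\<one> B \<otimes> \<Delta>) \<cdot> \<Delta>)"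
    by (simp add: swap_def comp_assoc coassoc tensor_compose_merge cocomm)
  then show ?thesis
    by (simp add: coassoc[symmetric])
qed

lemma b_iterated_symmetric:
  assumes "cocommutative_comonoid C B \<Delta> e" and "\<epsilon> \<in> hom C B A"
  defines "b \<equiv> (\<one> B \<otimes> \<epsilon>) \<cdot> \<Delta>"
  shows "swap B A A \<cdot> ((b \<otimes> \<one> A) \<cdot> b) = (b \<otimes> \<one> A) \<cdot> b"
proof -
  have [simp]: "\<epsilon> \<in> arr C" "src C \<epsilon> = B" "tgt C \<epsilon> = A" "A \<in> obj C"
    using assms(2) by (auto simp: in_hom)
  have [simp]: "B \<in> obj C" "\<Delta> \<in> arr C" "src C \<Delta> = B" "tgt C \<Delta> = B \<otimes>\<^sub>o B"
    using assms(1) by (auto simp: cocommutative_comonoid_def in_hom)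
  have b: "(b \<otimes> \<one> A) \<cdot> b = ((\<one> B \<otimes> \<epsilon>) \<otimes> \<epsilon>) \<cdot> ((\<Delta> \<otimes> \<one> B) \<cdot> \<Delta>)"
    by (simp add: b_def tensor_compose_merge)
  have "swap B A A \<cdot> ((\<one> B \<otimes> \<epsilon>) \<otimes> \<epsilon>) = ((\<one> B \<otimes> \<epsilon>) \<otimes> \<epsilon>) \<cdot> swap B B B"
    by (subst swap_nat) simp_all
  from comp_reassoc[OF this, of "(\<Delta> \<otimes> \<one> B) \<cdot> \<Delta>"] show ?thesis
    unfolding b by (simp add: comp_assoc cocommutative_iterated_symmetric[OF assms(1)])
qed

end


section \<open>The commuting action on the exponential\<close>

context linear_symmetric_monoidal_category
begin

lemma add_typing [simp]:
  assumes "f \<in> arr C" "g \<in> arr C" "src C g = src C f" "tgt C g = tgt C f"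
  shows "f \<oplus> g \<in> arr C" "src C (f \<oplus> g) = src C f" "tgt C (f \<oplus> g) = tgt C f"
proof -
  interpret rig_module "hom C (src C f) (tgt C f)" "add_arr C" "\<zero> (src C f) (tgt C f)" "smult_arr C"
    using assms by (simp add: hom_module)
  show "f \<oplus> g \<in> arr C" "src C (f \<oplus> g) = src C f" "tgt C (f \<oplus> g) = tgt C f"
    using add_closed[of f g] assms by (simp_all add: in_hom)
qed

lemma compose_add:
  assumes "f \<in> arr C" "g \<in> arr C" "h \<in> arr C" "src C g = src C f" "tgt C g = tgt C f"
  shows "src C h = tgt C f \<Longrightarrow> h \<cdot> (f \<oplus> g) = h \<cdot> f \<oplus> h \<cdot> g"
    "tgt C h = src C f \<Longrightarrow> (f \<oplus> g) \<cdot> h = f \<cdot> h \<oplus> g \<cdot> h"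
  using compose_add_right[of f "src C f" "tgt C f" g h "tgt C h"]
    compose_add_left[of h "src C h" "src C f" f "tgt C f" g] assms
  by (simp_all add: in_hom)

lemma add_tensor:
  assumes "f \<in> arr C" "g \<in> arr C" "h \<in> arr C" "src C g = src C f" "tgt C g = tgt C f"
  shows "(f \<oplus> g) \<otimes> h = (f \<otimes> h) \<oplus> (g \<otimes> h)"
  using tensor_add_left[of f "src C f" "tgt C f" g h "src C h" "tgt C h"] assms
  by (simp add: in_hom)

text \<open>The product rule splits \<open>\<Delta> \<cdot> d\<close> according to which output receives the derivative. If it is the
  one to which \<open>\<epsilon>\<close> is applied, the linear rule turns it into a counit and the identity remains;
  otherwise \<open>\<epsilon>\<close> meets \<open>\<Delta>\<close> directly and a new \<open>b\<close> appears.\<close>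

lemma b_after_d:
  assumes [simp]: "A \<in> obj C"
    and d: "d A \<in> hom C (bang A \<otimes>\<^sub>o A) (bang A)"
    and \<epsilon>: "\<epsilon> A \<in> hom C (bang A) A"
    and comonoid: "cocommutative_comonoid C (bang A) (\<Delta> A) (e A)"
    and product: "product_rule C bang d \<Delta> A"
    and linear: "linear_rule C d e \<epsilon> A"
  shows "b_map C bang \<Delta> \<epsilon> A \<cdot> d A = \<one> (bang A \<otimes>\<^sub>o A) \<oplus>
    (d A \<otimes> \<one> A) \<cdot> (swap (bang A) A A \<cdot> (b_map C bang \<Delta> \<epsilon> A \<otimes> \<one> A))"
proof -
  define B where "B = bang A"
  have [simp]: "B \<in> obj C" "d A \<in> arr C" "src C (d A) = B \<otimes>\<^sub>o A" "tgt C (d A) = B"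
      "\<epsilon> A \<in> arr C" "src C (\<epsilon> A) = B" "tgt C (\<epsilon> A) = A"
      "\<Delta> A \<in> arr C" "src C (\<Delta> A) = B" "tgt C (\<Delta> A) = B \<otimes>\<^sub>o B"
      "e A \<in> arr C" "src C (e A) = B" "tgt C (e A) = I"
    and counit: "\<r> B \<cdot> ((\<one> B \<otimes> e A) \<cdot> \<Delta> A) = \<one> B"
    using d \<epsilon> comonoid by (auto simp: B_def cocommutative_comonoid_def in_hom comp_assoc)
  define b where "b = (\<one> B \<otimes> \<epsilon> A) \<cdot> \<Delta> A"
  have lin: "\<epsilon> A \<cdot> d A = \<l> A \<cdot> (e A \<otimes> \<one> A)"
    using linear by (simp add: linear_rule_def)
  have prod: "\<Delta> A \<cdot> d A = (\<one> B \<otimes> d A) \<cdot> (\<a> B B A \<cdot> (\<Delta> A \<otimes> \<one> A)) \<oplus>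
      (d A \<otimes> \<one> B) \<cdot> (swap B B A \<cdot> (\<Delta> A \<otimes> \<one> A))"
    using product by (simp add: product_rule_def B_def[symmetric] swap_def compose_add comp_assoc)
  have e_nat: "\<a> B I A \<cdot> ((\<one> B \<otimes> e A) \<otimes> \<one> A) = (\<one> B \<otimes> (e A \<otimes> \<one> A)) \<cdot> \<a> B B A"
    by (subst associator_nat) simp_all
  have "(\<one> B \<otimes> \<epsilon> A) \<cdot> ((\<one> B \<otimes> d A) \<cdot> (\<a> B B A \<cdot> (\<Delta> A \<otimes> \<one> A))) =
      (\<one> B \<otimes> \<l> A) \<cdot> (((\<one> B \<otimes> (e A \<otimes> \<one> A)) \<cdot> \<a> B B A) \<cdot> (\<Delta> A \<otimes> \<one> A))"
    by (simp add: tensor_compose_merge lin comp_assoc)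
  also have "\<dots> = ((\<one> B \<otimes> \<l> A) \<cdot> \<a> B I A) \<cdot> (((\<one> B \<otimes> e A) \<otimes> \<one> A) \<cdot> (\<Delta> A \<otimes> \<one> A))"
    by (simp only: e_nat[symmetric]) (simp add: comp_assoc)
  also have "\<dots> = \<one> (B \<otimes>\<^sub>o A)"
    by (simp add: triangle tensor_compose_merge counit)
  finally have first: "(\<one> B \<otimes> \<epsilon> A) \<cdot> ((\<one> B \<otimes> d A) \<cdot> (\<a> B B A \<cdot> (\<Delta> A \<otimes> \<one> A))) =
      \<one> (B \<otimes>\<^sub>o A)" .
  have \<epsilon>_nat: "(\<one> (B \<otimes>\<^sub>o A) \<otimes> \<epsilon> A) \<cdot> swap B B A = swap B A A \<cdot> ((\<one> B \<otimes> \<epsilon> A) \<otimes> \<one> A)"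
    by (subst swap_nat) simp_all
  have "(\<one> B \<otimes> \<epsilon> A) \<cdot> ((d A \<otimes> \<one> B) \<cdot> (swap B B A \<cdot> (\<Delta> A \<otimes> \<one> A))) =
      (d A \<otimes> \<one> A) \<cdot> (((\<one> (B \<otimes>\<^sub>o A) \<otimes> \<epsilon> A) \<cdot> swap B B A) \<cdot> (\<Delta> A \<otimes> \<one> A))"
    by (simp add: tensor_compose_merge comp_assoc)
  also have "\<dots> = (d A \<otimes> \<one> A) \<cdot> (swap B A A \<cdot> (b \<otimes> \<one> A))"
    by (simp only: \<epsilon>_nat) (simp add: comp_assoc tensor_compose_merge b_def)
  finally have "b \<cdot> d A = \<one> (B \<otimes>\<^sub>o A) \<oplus> (d A \<otimes> \<one> A) \<cdot> (swap B A A \<cdot> (b \<otimes> \<one> A))"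
    by (simp add: b_def comp_assoc prod compose_add first)
  then show ?thesis by (simp add: b_map_def b_def B_def)
qed

text \<open>\<open>T1\<close> and \<open>T2\<close> are the two summands of \<open>\<beta> \<cdot> (\<beta> \<otimes> X)\<close> that come from \<open>b_after_d\<close>. Each is
  separately invariant under the exchange \<open>u\<close> of the two copies of \<open>X\<close>.\<close>

lemma bang_action_commuting:
  assumes [simp]: "A \<in> obj C" "X \<in> obj C"
    and d: "d A \<in> hom C (bang A \<otimes>\<^sub>o A) (bang A)"
    and \<epsilon>: "\<epsilon> A \<in> hom C (bang A) A"
    and comonoid: "cocommutative_comonoid C (bang A) (\<Delta> A) (e A)"
    and interchange: "interchange_rule C bang d A"
    and product: "product_rule C bang d \<Delta> A"
    and linear: "linear_rule C d e \<epsilon> A"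
    and \<alpha>: "commuting_action C X (A, \<alpha>)"
  shows "commuting_action C X (bang_action C bang d \<Delta> \<epsilon> X (A, \<alpha>))"
proof -
  define B where "B = bang A"
  define b where "b = b_map C bang \<Delta> \<epsilon> A"
  define D where "D = d A"
  define s where "s = swap B A A"
  define u where "u = swap B X X"
  define p where "p = act B A X \<alpha>"
  define q where "q = act (B \<otimes>\<^sub>o A) A X \<alpha>"
  define \<beta> where "\<beta> = D \<cdot> (p \<cdot> (b \<otimes> \<one> X))"
  have [simp]: "\<alpha> \<in> arr C" "src C \<alpha> = A \<otimes>\<^sub>o X" "tgt C \<alpha> = A"
    using \<alpha> by (auto simp: commuting_action_def in_hom)
  have [simp]: "B \<in> obj C" "D \<in> arr C" "src C D = B \<otimes>\<^sub>o A" "tgt C D = B"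
      "b \<in> arr C" "src C b = B" "tgt C b = B \<otimes>\<^sub>o A"
    using d \<epsilon> comonoid
    by (auto simp: B_def D_def b_def b_map_def cocommutative_comonoid_def in_hom)
  have [simp]: "s \<in> arr C" "src C s = (B \<otimes>\<^sub>o A) \<otimes>\<^sub>o A" "tgt C s = (B \<otimes>\<^sub>o A) \<otimes>\<^sub>o A"
    by (simp_all add: s_def)
  have [simp]: "u \<in> arr C" "src C u = (B \<otimes>\<^sub>o X) \<otimes>\<^sub>o X" "tgt C u = (B \<otimes>\<^sub>o X) \<otimes>\<^sub>o X"
    by (simp_all add: u_def)
  have [simp]: "p \<in> arr C" "src C p = (B \<otimes>\<^sub>o A) \<otimes>\<^sub>o X" "tgt C p = B \<otimes>\<^sub>o A"
    by (simp_all add: p_def)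
  have [simp]: "q \<in> arr C" "src C q = ((B \<otimes>\<^sub>o A) \<otimes>\<^sub>o A) \<otimes>\<^sub>o X" "tgt C q = (B \<otimes>\<^sub>o A) \<otimes>\<^sub>o A"
    by (simp_all add: q_def)
  have [simp]: "\<beta> \<in> arr C" "src C \<beta> = B \<otimes>\<^sub>o X" "tgt C \<beta> = B"
    by (simp_all add: \<beta>_def)
  have bD: "b \<cdot> D = \<one> (B \<otimes>\<^sub>o A) \<oplus> (D \<otimes> \<one> A) \<cdot> (s \<cdot> (b \<otimes> \<one> A))"
    using b_after_d[where d=d and bang=bang and \<epsilon>=\<epsilon> and \<Delta>=\<Delta> and e=e and A=A, OF assms(1) d \<epsilon> comonoid product linear]
    by (simp add: b_def B_def D_def s_def)
  have D_symm: "D \<cdot> ((D \<otimes> \<one> A) \<cdot> s) = D \<cdot> (D \<otimes> \<one> A)"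
    using interchange d
    by (simp add: interchange_rule_def B_def[symmetric] D_def[symmetric] s_def swap_def comp_assoc)
  have b_symm: "s \<cdot> ((b \<otimes> \<one> A) \<cdot> b) = (b \<otimes> \<one> A) \<cdot> b"
    using b_iterated_symmetric[OF comonoid \<epsilon>] by (simp add: s_def b_def b_map_def B_def)
  have pD: "p \<cdot> ((D \<otimes> \<one> A) \<otimes> \<one> X) = (D \<otimes> \<one> A) \<cdot> q"
    unfolding p_def q_def by (subst act_nat) simp_all
  have bp: "(b \<otimes> \<one> A) \<cdot> p = q \<cdot> ((b \<otimes> \<one> A) \<otimes> \<one> X)"
    unfolding p_def q_def by (subst act_nat) simp_all
  define bX where "bX = (b \<otimes> \<one> X) \<otimes> \<one> X"
  define bbX where "bbX = (((b \<otimes> \<one> A) \<cdot> b) \<otimes> \<one> X) \<otimes> \<one> X"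
  define Y where "Y = q \<cdot> ((s \<otimes> \<one> X) \<cdot> (q \<otimes> \<one> X))"
  have [simp]: "bX \<in> arr C" "src C bX = (B \<otimes>\<^sub>o X) \<otimes>\<^sub>o X"
    "tgt C bX = ((B \<otimes>\<^sub>o A) \<otimes>\<^sub>o X) \<otimes>\<^sub>o X"
    by (simp_all add: bX_def)
  have [simp]: "bbX \<in> arr C" "src C bbX = (B \<otimes>\<^sub>o X) \<otimes>\<^sub>o X"
    "tgt C bbX = (((B \<otimes>\<^sub>o A) \<otimes>\<^sub>o A) \<otimes>\<^sub>o X) \<otimes>\<^sub>o X"
    by (simp_all add: bbX_def)
  have [simp]: "Y \<in> arr C" "src C Y = (((B \<otimes>\<^sub>o A) \<otimes>\<^sub>o A) \<otimes>\<^sub>o X) \<otimes>\<^sub>o X"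
    "tgt C Y = (B \<otimes>\<^sub>o A) \<otimes>\<^sub>o A"
    by (simp_all add: Y_def)
  define T1 where "T1 = D \<cdot> (p \<cdot> ((p \<otimes> \<one> X) \<cdot> bX))"
  define T2 where "T2 = D \<cdot> ((D \<otimes> \<one> A) \<cdot> (Y \<cdot> bbX))"
  have [simp]: "T1 \<in> arr C" "src C T1 = (B \<otimes>\<^sub>o X) \<otimes>\<^sub>o X" "tgt C T1 = B"
    "T2 \<in> arr C" "src C T2 = (B \<otimes>\<^sub>o X) \<otimes>\<^sub>o X" "tgt C T2 = B"
    by (simp_all add: T1_def T2_def)
  have mixed: "p \<cdot> ((((D \<otimes> \<one> A) \<cdot> (s \<cdot> (b \<otimes> \<one> A))) \<otimes> \<one> X) \<cdot> ((p \<otimes> \<one> X) \<cdot> bX)) =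
      (D \<otimes> \<one> A) \<cdot> (Y \<cdot> bbX)" (is "?l = _")
  proof -
    have "?l = (p \<cdot> ((D \<otimes> \<one> A) \<otimes> \<one> X)) \<cdot>
        ((s \<otimes> \<one> X) \<cdot> ((((b \<otimes> \<one> A) \<cdot> p) \<otimes> \<one> X) \<cdot> bX))"
      by (simp add: comp_assoc tensor_compose_merge)
    also have "\<dots> = (D \<otimes> \<one> A) \<cdot> (Y \<cdot> bbX)"
      unfolding pD bp by (simp add: comp_assoc tensor_compose_merge Y_def bX_def bbX_def)
    finally show ?thesis .
  qed
  have "\<beta> \<cdot> (\<beta> \<otimes> \<one> X) = D \<cdot> (p \<cdot> (((b \<cdot> D) \<otimes> \<one> X) \<cdot> ((p \<otimes> \<one> X) \<cdot> bX)))"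
    by (simp add: \<beta>_def comp_assoc tensor_compose_merge bX_def)
  also have "\<dots> = T1 \<oplus> T2"
    by (simp add: bD add_tensor compose_add mixed T1_def T2_def)
  finally have \<beta>\<beta>: "\<beta> \<cdot> (\<beta> \<otimes> \<one> X) = T1 \<oplus> T2" .
  have bXu: "bX \<cdot> u = swap (B \<otimes>\<^sub>o A) X X \<cdot> bX"
    unfolding bX_def u_def by (subst swap_nat) simp_all
  have p_comm: "p \<cdot> ((p \<otimes> \<one> X) \<cdot> swap (B \<otimes>\<^sub>o A) X X) = p \<cdot> (p \<otimes> \<one> X)"
    unfolding p_def by (rule commuting_action_act[OF \<alpha>]) simp_all
  have "T1 \<cdot> u = D \<cdot> ((p \<cdot> ((p \<otimes> \<one> X) \<cdot> swap (B \<otimes>\<^sub>o A) X X)) \<cdot> bX)"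
    by (simp add: T1_def comp_assoc bXu)
  then have T1: "T1 \<cdot> u = T1"
    unfolding p_comm by (simp add: T1_def comp_assoc)
  have bbXu: "bbX \<cdot> u = swap ((B \<otimes>\<^sub>o A) \<otimes>\<^sub>o A) X X \<cdot> bbX"
    unfolding bbX_def u_def by (subst swap_nat) simp_all
  have s_bbX: "((s \<otimes> \<one> X) \<otimes> \<one> X) \<cdot> bbX = bbX"
    by (simp add: bbX_def tensor_compose_merge b_symm)
  have Y_swap: "Y \<cdot> swap ((B \<otimes>\<^sub>o A) \<otimes>\<^sub>o A) X X = s \<cdot> (Y \<cdot> ((s \<otimes> \<one> X) \<otimes> \<one> X))"
    unfolding Y_def q_def s_def by (rule act_twice_symmetric) simp_all
  have "T2 \<cdot> u = D \<cdot> ((D \<otimes> \<one> A) \<cdot> ((Y \<cdot> swap ((B \<otimes>\<^sub>o A) \<otimes>\<^sub>o A) X X) \<cdot> bbX))"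
    by (simp add: T2_def comp_assoc bbXu)
  also have "\<dots> = (D \<cdot> ((D \<otimes> \<one> A) \<cdot> s)) \<cdot> (Y \<cdot> bbX)"
    unfolding Y_swap by (simp add: comp_assoc s_bbX)
  also have "\<dots> = T2"
    unfolding D_symm by (simp add: T2_def comp_assoc)
  finally have T2: "T2 \<cdot> u = T2" .
  have "\<beta> \<cdot> ((\<beta> \<otimes> \<one> X) \<cdot> u) = (T1 \<oplus> T2) \<cdot> u"
    by (simp add: \<beta>\<beta>[symmetric] comp_assoc)
  also have "\<dots> = \<beta> \<cdot> (\<beta> \<otimes> \<one> X)"
    by (simp add: compose_add T1 T2 \<beta>\<beta>)
  finally have "commuting_action C X (B, \<beta>)"
    by (simp add: commuting_action_def in_hom u_def swap_def comp_assoc)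
  moreover have "bang_action C bang d \<Delta> \<epsilon> X (A, \<alpha>) = (B, \<beta>)"
    by (simp add: bang_action_def \<beta>_def p_def act_def comp_assoc
        B_def[symmetric] b_def[symmetric] D_def[symmetric])
  ultimately show ?thesis by simp
qed


section \<open>The chain rule as a map of actions\<close>

text \<open>A comonoid morphism \<open>\<delta>\<close> with \<open>\<epsilon> \<cdot> \<delta> = 1\<close> satisfies \<open>b \<cdot> \<delta> = (\<delta> \<otimes> 1) \<cdot> \<Delta>\<close>: copying commutes
  with \<open>\<delta>\<close>, and \<open>\<epsilon>\<close> then cancels \<open>\<delta>\<close> on the second copy.\<close>

lemma bang_action_after_comultiplication:
  assumes [simp]: "X \<in> obj C"
    and d: "d X \<in> hom C (bang X \<otimes>\<^sub>o X) (bang X)" "d (bang X) \<in> hom C (bang (bang X) \<otimes>\<^sub>o bang X) (bang (bang X))"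
    and \<Delta>: "\<Delta> X \<in> hom C (bang X) (bang X \<otimes>\<^sub>o bang X)"
      "\<Delta> (bang X) \<in> hom C (bang (bang X)) (bang (bang X) \<otimes>\<^sub>o bang (bang X))"
    and \<epsilon>: "\<epsilon> (bang X) \<in> hom C (bang (bang X)) (bang X)"
    and \<delta>: "comonoid_morphism C (bang X) (\<Delta> X) (e X) (bang (bang X)) (\<Delta> (bang X)) (e (bang X)) (\<delta> X)"
    and counit: "\<epsilon> (bang X) \<cdot> \<delta> X = \<one> (bang X)"
  shows "snd (bang_action C bang d \<Delta> \<epsilon> X (bang X, d X)) \<cdot> (\<delta> X \<otimes> \<one> X) =
    d (bang X) \<cdot> (\<delta> X \<otimes> d X) \<cdot> \<a> (bang X) (bang X) X \<cdot> (\<Delta> X \<otimes> \<one> X)"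
proof -
  define B where "B = bang X"
  define B' where "B' = bang B"
  have [simp]: "d X \<in> arr C" "src C (d X) = B \<otimes>\<^sub>o X" "tgt C (d X) = B"
      "d B \<in> arr C" "src C (d B) = B' \<otimes>\<^sub>o B" "tgt C (d B) = B'"
      "\<epsilon> B \<in> arr C" "src C (\<epsilon> B) = B'" "tgt C (\<epsilon> B) = B"
      "\<Delta> X \<in> arr C" "src C (\<Delta> X) = B" "tgt C (\<Delta> X) = B \<otimes>\<^sub>o B"
      "\<Delta> B \<in> arr C" "src C (\<Delta> B) = B'" "tgt C (\<Delta> B) = B' \<otimes>\<^sub>o B'"
      "\<delta> X \<in> arr C" "src C (\<delta> X) = B" "tgt C (\<delta> X) = B'"
    and copy: "\<Delta> B \<cdot> \<delta> X = (\<delta> X \<otimes> \<delta> X) \<cdot> \<Delta> X"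
    and sec: "\<epsilon> B \<cdot> \<delta> X = \<one> B"
    using assms by (auto simp: B_def B'_def comonoid_morphism_def in_hom)
  have [simp]: "B \<in> obj C" "B' \<in> obj C"
    using src_obj[of "\<delta> X"] tgt_obj[of "\<delta> X"] by simp_all
  have b\<delta>: "b_map C bang \<Delta> \<epsilon> B \<cdot> \<delta> X = (\<delta> X \<otimes> \<one> B) \<cdot> \<Delta> X"
    by (simp add: b_map_def B'_def[symmetric] comp_assoc copy tensor_compose_merge sec)
  have [simp]: "b_map C bang \<Delta> \<epsilon> B \<in> arr C" "src C (b_map C bang \<Delta> \<epsilon> B) = B'"
    "tgt C (b_map C bang \<Delta> \<epsilon> B) = B' \<otimes>\<^sub>o B"
    by (simp_all add: b_map_def B'_def[symmetric])
  have \<delta>_nat: "\<a> B' B X \<cdot> ((\<delta> X \<otimes> \<one> B) \<otimes> \<one> X) = (\<delta> X \<otimes> (\<one> B \<otimes> \<one> X)) \<cdot> \<a> B B X"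
    by (subst associator_nat) simp_all
  have "snd (bang_action C bang d \<Delta> \<epsilon> X (B, d X)) \<cdot> (\<delta> X \<otimes> \<one> X) =
      d B \<cdot> ((\<one> B' \<otimes> d X) \<cdot> (\<a> B' B X \<cdot> (((\<delta> X \<otimes> \<one> B) \<otimes> \<one> X) \<cdot> (\<Delta> X \<otimes> \<one> X))))"
    by (simp add: bang_action_def B'_def[symmetric] comp_assoc tensor_compose_merge b\<delta>)
  also have "\<dots> = d B \<cdot> ((\<delta> X \<otimes> d X) \<cdot> (\<a> B B X \<cdot> (\<Delta> X \<otimes> \<one> X)))"
    by (subst comp_reassoc[OF \<delta>_nat]) (simp_all add: comp_assoc tensor_compose_merge)
  finally show ?thesis
    by (simp add: B_def[symmetric] comp_assoc)
qed

end

theorem lemma46: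
  fixes C :: "('o, 'm, 'k::{comm_semiring_0, comm_monoid_mult}) linear_smc"
    and bang :: "'o \<Rightarrow> 'o" and bang_arr :: "'m \<Rightarrow> 'm"
    and d e \<Delta> \<epsilon> \<delta> :: "'o \<Rightarrow> 'm"
  assumes "linear_symmetric_monoidal_category C"
    and "has_finite_biproducts C"
    and "endofunctor C bang bang_arr"
    and "\<And>X. X \<in> obj C \<Longrightarrow> d X \<in> hom C (bang X \<otimes>\<^sub>o\<^bsub>C\<^esub> X) (bang X)"
    and "\<And>X. X \<in> obj C \<Longrightarrow> e X \<in> hom C (bang X) I\<^bsub>C\<^esub>"
    and "\<And>X. X \<in> obj C \<Longrightarrow> \<Delta> X \<in> hom C (bang X) (bang X \<otimes>\<^sub>o\<^bsub>C\<^esub> bang X)"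
    and "\<And>X. X \<in> obj C \<Longrightarrow> \<epsilon> X \<in> hom C (bang X) X"
    and "\<And>X. X \<in> obj C \<Longrightarrow> cocommutative_comonoid C (bang X) (\<Delta> X) (e X)"
    and "\<And>X. X \<in> obj C \<Longrightarrow> interchange_rule C bang d X"
    and "\<And>X. X \<in> obj C \<Longrightarrow> constant_rule C bang d e X"
    and "\<And>X. X \<in> obj C \<Longrightarrow> product_rule C bang d \<Delta> X"
    and "\<And>X. X \<in> obj C \<Longrightarrow> linear_rule C d e \<epsilon> X"
    and "\<And>X. X \<in> obj C \<Longrightarrow> \<delta> X \<in> hom C (bang X) (bang (bang X))"
    and "\<And>X. X \<in> obj C \<Longrightarrow>
      comonoid_morphism C (bang X) (\<Delta> X) (e X) (bang (bang X)) (\<Delta> (bang X)) (e (bang X)) (\<delta> X)"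
    and "\<And>X. X \<in> obj C \<Longrightarrow> \<epsilon> (bang X) \<cdot>\<^bsub>C\<^esub> \<delta> X = \<one>\<^bsub>C\<^esub> (bang X)"
  shows "(\<forall>X \<in> obj C. action_map C X (bang X, d X)
            (bang_action C bang d \<Delta> \<epsilon> X (bang X, d X)) (\<delta> X)) \<longleftrightarrow>
         (\<forall>X \<in> obj C. chain_rule C bang d \<Delta> \<delta> X)"
proof (intro ball_cong refl)
  interpret linear_symmetric_monoidal_category C by fact
  fix X
  assume X: "X \<in> obj C"
  have BX: "bang X \<in> obj C"
    using assms(3) X by (simp add: endofunctor_def)
  have source: "commuting_action C X (bang X, d X)"
    using assms(4,9)[OF X] BX by (simp add: commuting_action_def interchange_rule_def)
  have target: "commuting_action C X (bang_action C bang d \<Delta> \<epsilon> X (bang X, d X))"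
    using bang_action_commuting[where d=d and bang=bang and \<epsilon>=\<epsilon> and \<Delta>=\<Delta> and e=e,
        OF BX X assms(4,7,8,9,11,12)[OF BX] source] .
  obtain \<beta> where \<beta>: "bang_action C bang d \<Delta> \<epsilon> X (bang X, d X) = (bang (bang X), \<beta>)"
    by (simp add: bang_action_def)
  have "\<beta> \<cdot>\<^bsub>C\<^esub> (\<delta> X \<otimes>\<^bsub>C\<^esub> \<one>\<^bsub>C\<^esub> X) =
      d (bang X) \<cdot>\<^bsub>C\<^esub> (\<delta> X \<otimes>\<^bsub>C\<^esub> d X) \<cdot>\<^bsub>C\<^esub> \<a>\<^bsub>C\<^esub> (bang X) (bang X) X \<cdot>\<^bsub>C\<^esub>
        (\<Delta> X \<otimes>\<^bsub>C\<^esub> \<one>\<^bsub>C\<^esub> X)"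
    using bang_action_after_comultiplication[where d=d and bang=bang and \<epsilon>=\<epsilon> and \<Delta>=\<Delta> and e=e and \<delta>=\<delta>,
        OF X assms(4)[OF X] assms(4)[OF BX] assms(6)[OF X] assms(6)[OF BX] assms(7)[OF BX]
          assms(14,15)[OF X]] \<beta>
    by simp
  then show "action_map C X (bang X, d X) (bang_action C bang d \<Delta> \<epsilon> X (bang X, d X)) (\<delta> X) \<longleftrightarrow>
      chain_rule C bang d \<Delta> \<delta> X"
    using source target assms(13)[OF X] unfolding \<beta> action_map_def chain_rule_def by simp
qed

end
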